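(* Let $n\ge 1$, let $A\in\mathbb{R}^{n\times n}$ be nonsingular, and let $\mathbf{v},\mathbf{w}\in\mathbb{R}^n$ be column vectors. Then $$\mathbf{w}^T\operatorname{adj}(A)=\mathbf{w}^T\operatorname{adj}(A+\mathbf{v}\mathbf{w}^T).$$
   Context: $\operatorname{adj}(M)$ denotes the classical adjoint (adjugate) of a square matrix $M$, i.e. the transpose of its cofactor matrix, so $\operatorname{adj}(M)=\det(M)M^{-1}$ when $M$ is nonsingular. *)

theory Defs
  imports "Jordan_Normal_Form.Determinant"
begin

end

theory Submission
  imports Defs
begin

text \<open>Cramer's rule reads the \<open>j\<close>-th entry of \<open>w\<^sup>T adj A\<close> as the determinant of \<open>A\<close> with row \<open>j\<close>
  replaced by \<open>w\<^sup>T\<close>. The update \<open>A + v w\<^sup>T\<close> only adds multiples of \<open>w\<^sup>T\<close> to the other rows, so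
  this determinant does not change.\<close>

definition replace_row :: "'a mat \<Rightarrow> nat \<Rightarrow> 'a vec \<Rightarrow> 'a mat" where
  "replace_row A j x = mat (dim_row A) (dim_col A) (\<lambda>(i, k). if i = j then x $ k else A $$ (i, k))"

lemma replace_row_carrier [simp]:
  "A \<in> carrier_mat m n \<Longrightarrow> replace_row A j x \<in> carrier_mat m n"
  by (simp add: replace_row_def)

text \<open>A cofactor along row \<open>j\<close> is computed after deleting row \<open>j\<close>,
  so it cannot see what was put there.\<close>

lemma cofactor_replace_row:
  assumes "A \<in> carrier_mat n n" and "j < n"
  shows "cofactor (replace_row A j x) j k = cofactor A j k"
proof -
  have "mat_delete (replace_row A j x) j k = mat_delete A j k"
    using assms by (intro eq_matI) (auto simp: mat_delete_def replace_row_def)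
  then show ?thesis
    by (simp add: cofactor_def)
qed

lemma det_replace_row:
  fixes A :: "'a :: comm_ring_1 mat"
  assumes "A \<in> carrier_mat n n" and "j < n"
  shows "det (replace_row A j x) = (\<Sum>k<n. x $ k * cofactor A j k)"
proof -
  have "det (replace_row A j x)
      = (\<Sum>k<n. replace_row A j x $$ (j, k) * cofactor (replace_row A j x) j k)"
    using assms by (intro laplace_expansion_row) auto
  also have "\<dots> = (\<Sum>k<n. x $ k * cofactor A j k)"
    using assms by (intro sum.cong) (simp_all add: cofactor_replace_row, simp add: replace_row_def)
  finally show ?thesis .
qed

text \<open>The adjugate carries \<open>cofactor A j k\<close> at position \<open>(k, j)\<close>, so
  the scalar product of \<open>col w i\<close> with its column \<open>j\<close> is the Laplace
  expansion of the replaced matrix along row \<open>j\<close>.\<close>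

lemma transpose_mult_adj_mat_index:
  fixes A w :: "'a :: comm_ring_1 mat"
  assumes "A \<in> carrier_mat n n" and "w \<in> carrier_mat n m" and "i < m" and "j < n"
  shows "(transpose_mat w * adj_mat A) $$ (i, j) = det (replace_row A j (col w i))"
  using assms
  by (auto simp: det_replace_row adj_mat_def scalar_prod_def atLeast0LessThan intro!: sum.cong)

text \<open>All these row operations together are one left multiplication by a matrix of determinant
  1.\<close>

lemma det_add_multiples_of_row:
  fixes A :: "'a :: comm_ring_1 mat"
  assumes A: "A \<in> carrier_mat n n" and j: "j < n"
  shows "det (mat n n (\<lambda>(i, k). if i = j then A $$ (i, k) else A $$ (i, k) + c i * A $$ (j, k)))
    = det A"
proof -
  \<comment> \<open>The identity with column \<open>j\<close> overwritten by \<open>c\<close> off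
    the diagonal. The test \<open>i = k\<close> comes first, so the entry at \<open>(j, j)\<close>
    is 1 whatever \<open>c j\<close> is.\<close>
  define E where "E = mat n n (\<lambda>(i, k). if i = k then 1 else if k = j then c i else 0)"
  have E: "E \<in> carrier_mat n n"
    by (simp add: E_def)
  \<comment> \<open>All off-diagonal entries that may be nonzero lie in the deleted column
    \<open>j\<close>.\<close>
  have delete: "mat_delete E j j = 1\<^sub>m (n - 1)"
    using j by (intro eq_matI) (auto simp: E_def mat_delete_def)
  \<comment> \<open>Row \<open>j\<close> of \<open>E\<close> is a unit vector, so the expansion
    along it collapses to one cofactor.\<close>
  have "det E = (\<Sum>k<n. E $$ (j, k) * cofactor E j k)"
    by (rule laplace_expansion_row[OF E j])
  also have "\<dots> = (\<Sum>k<n. if k = j then cofactor E j k else 0)"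
    using j by (intro sum.cong) (auto simp: E_def)
  also have "\<dots> = cofactor E j j"
    using j by simp
  also have "\<dots> = 1"
    by (simp add: cofactor_def delete)
  finally have det_E: "det E = 1" .
  have "mat n n (\<lambda>(i, k). if i = j then A $$ (i, k) else A $$ (i, k) + c i * A $$ (j, k)) = E * A"
    (is "?B = _")
  proof (rule eq_matI)
    fix i k
    assume "i < dim_row (E * A)" and "k < dim_col (E * A)"
    then have i: "i < n" and k: "k < n"
      using A E by auto
    have "(E * A) $$ (i, k) = (\<Sum>l<n. E $$ (i, l) * A $$ (l, k))"
      using A E i k by (auto simp: scalar_prod_def atLeast0LessThan intro!: sum.cong)
    \<comment> \<open>The diagonal and column \<open>j\<close> of \<open>E\<close> are separated;
      the inner test \<open>i = j\<close> avoids counting their common entry twice.\<close>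
    also have "\<dots> = (\<Sum>l<n. (if l = i then A $$ (l, k) else 0)
        + (if l = j then if i = j then 0 else c i * A $$ (l, k) else 0))"
      using i by (intro sum.cong) (auto simp: E_def)
    also have "\<dots> = ?B $$ (i, k)"
      using i j k by (simp add: sum.distrib)
    finally show "?B $$ (i, k) = (E * A) $$ (i, k)" by simp
  qed (use A E in auto)
  then show ?thesis
    using det_mult[OF E A] det_E by simp
qed

theorem theorem2:
  fixes n :: nat and A v w :: "real mat"
  assumes "n \<ge> 1"
    and "A \<in> carrier_mat n n"
    and "invertible_mat A"
    and "v \<in> carrier_mat n 1"
    and "w \<in> carrier_mat n 1"
  shows "transpose_mat w * adj_mat A = transpose_mat w * adj_mat (A + v * transpose_mat w)"
proof (rule eq_matI)
  let ?B = "A + v * transpose_mat w"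
  have A: "A \<in> carrier_mat n n" and v: "v \<in> carrier_mat n 1" and w: "w \<in> carrier_mat n 1"
    by (fact assms)+
  have B: "?B \<in> carrier_mat n n"
    using A v w by simp
  note adj = adj_mat(1)[OF A] adj_mat(1)[OF B]
  show "dim_row (transpose_mat w * adj_mat A) = dim_row (transpose_mat w * adj_mat ?B)"
    and "dim_col (transpose_mat w * adj_mat A) = dim_col (transpose_mat w * adj_mat ?B)"
    using adj by auto
  fix i j
  assume "i < dim_row (transpose_mat w * adj_mat ?B)" and "j < dim_col (transpose_mat w * adj_mat ?B)"
  then have i: "i = 0" and j: "j < n"
    using w adj by auto
  let ?A' = "replace_row A j (col w 0)"
  \<comment> \<open>Row \<open>i\<close> of \<open>v * transpose_mat w\<close> is
    \<open>v $$ (i, 0)\<close> times the transpose of \<open>w\<close>, which is now row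
    \<open>j\<close> of \<open>?A'\<close>. So outside row \<open>j\<close> the update adds
    multiples of that row.\<close>
  have "replace_row ?B j (col w 0)
      = mat n n (\<lambda>(i, k). if i = j then ?A' $$ (i, k) else ?A' $$ (i, k) + v $$ (i, 0) * ?A' $$ (j, k))"
    using A v w j by (intro eq_matI) (auto simp: replace_row_def scalar_prod_def)
  then have "det (replace_row ?B j (col w 0)) = det ?A'"
    using det_add_multiples_of_row[of ?A' n j "\<lambda>i. v $$ (i, 0)"] A j by simp
  then show "(transpose_mat w * adj_mat A) $$ (i, j) = (transpose_mat w * adj_mat ?B) $$ (i, j)"
    using transpose_mult_adj_mat_index[OF A w _ j] transpose_mult_adj_mat_index[OF B w _ j] i by simp
qed

end
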